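(* Let $S=[M\mid\Lambda]$ with $M=\begin{pmatrix}A&B\\C&D\end{pmatrix}$ real, $\det M=1$, $B>0$, and $\Lambda=(p,q)^\top\in\mathbb R^2$. Let $\Omega_S>0$ and let $f\in L^2(\mathbb R)$ be band-limited to $(-\Omega_S,\Omega_S)$ in the special affine Fourier transform (SAFT) domain associated with $S$. Put $T=\frac{B\pi}{\Omega_S}$. Then $$f(x)=\exp\Big\{-\tfrac{i}{2B}\big(Ax^2+2xp\big)\Big\}\sum_{n\in\mathbb Z} f(nT)\,\exp\Big\{\tfrac{i}{2B}\big(A(nT)^2+2pnT\big)\Big\}\,\mathrm{sinc}\Big(\tfrac{\Omega_S(x-nT)}{B\pi}\Big).$$
   Context: The SAFT of $f\in L^2(\mathbb R)$ associated with $S$ (for $B>0$) is $\mathscr O_S[f](\zeta)=\int_{\mathbb R} f(x)\,\mathcal K_S(x,\zeta)\,dx$ (understood in the usual $L^2$ sense, as for the Fourier transform), with kernel $$\mathcal K_S(x,\zeta)=\frac{1}{\sqrt{2\pi iB}}\exp\Big\{\tfrac{i}{2B}\big(Ax^2+2x(p-\zeta)-2\zeta(Dp-Bq)+D(\zeta^2+p^2)\big)\Big\}.$$ A signal $f\in L^2(\mathbb R)$ is band-limited to $(-\Omega_S,\Omega_S)$ in the SAFT domain if $\mathscr O_S[f](\zeta)=0$ for (almost every) $|\zeta|\ge\Omega_S$; such an $f$ is identified with its continuous representative, so the samples $f(nT)$ make sense. The convention for sinc is $\mathrm{sinc}(x)=\frac{\sin(\pi x)}{\pi x}$ for $x\neq0$,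 $\mathrm{sinc}(0)=1$. *)

theory Defs
  imports "HOL-Analysis.Analysis"
begin

definition square_integrable :: "(real \<Rightarrow> complex) \<Rightarrow> bool" where
  "square_integrable f \<longleftrightarrow>
     f \<in> borel_measurable lborel \<and> integrable lborel (\<lambda>x. (norm (f x))\<^sup>2)"

text \<open>The parameter \<open>S = [M | L]\<close> is given by its matrix \<open>M\<close> and its offset vector \<open>L\<close>;
  the square root is the principal branch.\<close>

definition saft_kernel :: "real^2^2 \<Rightarrow> real^2 \<Rightarrow> real \<Rightarrow> real \<Rightarrow> complex" where
  "saft_kernel M L x \<zeta> =
    (let A = M $ 1 $ 1; B = M $ 1 $ 2; D = M $ 2 $ 2; p = L $ 1; q = L $ 2
     in 1 / csqrt (2 * of_real pi * \<i> * of_real B) *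
        exp (\<i> / (2 * of_real B) *
          of_real (A * x\<^sup>2 + 2 * x * (p - \<zeta>) - 2 * \<zeta> * (D * p - B * q) + D * (\<zeta>\<^sup>2 + p\<^sup>2))))"

definition saft_truncated ::
    "real^2^2 \<Rightarrow> real^2 \<Rightarrow> (real \<Rightarrow> complex) \<Rightarrow> real \<Rightarrow> real \<Rightarrow> complex" where
  "saft_truncated M L f R \<zeta> = (LINT x:{-R..R}|lborel. f x * saft_kernel M L x \<zeta>)"

text \<open>For \<open>f\<close> in \<open>L\<^sup>2\<close> the transform is the limit in the \<open>L\<^sup>2\<close> norm of the truncated integrals
  as \<open>R\<close> tends to infinity. It is determined only up to a null set, hence a relation. The
  squared distance is an extended nonnegative integral, so that it cannot vanish by
  non-integrability.\<close>

definition has_saft ::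
    "real^2^2 \<Rightarrow> real^2 \<Rightarrow> (real \<Rightarrow> complex) \<Rightarrow> (real \<Rightarrow> complex) \<Rightarrow> bool" where
  "has_saft M L f g \<longleftrightarrow>
     square_integrable g \<and>
     ((\<lambda>R. \<integral>\<^sup>+ \<zeta>. ennreal ((norm (saft_truncated M L f R \<zeta> - g \<zeta>))\<^sup>2) \<partial>lborel) \<longlongrightarrow> 0) at_top"

definition saft_band_limited :: "real^2^2 \<Rightarrow> real^2 \<Rightarrow> real \<Rightarrow> (real \<Rightarrow> complex) \<Rightarrow> bool" where
  "saft_band_limited M L \<Omega> f \<longleftrightarrow>
     (\<exists>g. has_saft M L f g \<and> (AE \<zeta> in lborel. \<bar>\<zeta>\<bar> \<ge> \<Omega> \<longrightarrow> g \<zeta> = 0))"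

definition continuous_representative :: "(real \<Rightarrow> complex) \<Rightarrow> (real \<Rightarrow> complex) \<Rightarrow> bool" where
  "continuous_representative f f0 \<longleftrightarrow>
     continuous_on UNIV f0 \<and> (AE x in lborel. f0 x = f x)"

text \<open>The normalised sinc; the constant \<open>sinc\<close> of the library is \<open>sin x / x\<close>.\<close>

definition normalized_sinc :: "real \<Rightarrow> real" where
  "normalized_sinc x = (if x = 0 then 1 else sin (pi * x) / (pi * x))"

end

theory Submission imports Defs "HOL-Probability.Probability" begin

text \<open>
  Multiplying \<open>f\<close> by the chirp \<open>e x = exp (i (A x^2 + 2 p x) / (2 B))\<close> turns the transform into an
  ordinary Fourier transform: with \<open>h = e f\<close>, the transform of \<open>f\<close> at \<open>\<zeta>\<close> is the
  Fourier transform of \<open>h\<close> at frequency \<open>\<zeta> / B\<close>, times a factor of constant nonzero modulus.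
  Hence \<open>h\<close> is band-limited to \<open>[-W, W]\<close> with \<open>W = \<Omega> / B\<close>, and the claim is Shannon's sampling
  theorem for \<open>h\<close> with step \<open>T = \<pi> / W\<close>. Two facts about Fourier integrals carry it.

  \<^item> Inversion (\<open>fourier_inversion_L2\<close>). Suppose the Fourier integrals of the truncations of \<open>h\<close>
    converge in \<open>L\<^sup>2\<close> to an integrable \<open>G\<close>. Pairing them with the Gaussian centred at \<open>a\<close> and moving
    the Fourier integral onto the Gaussian by Fubini shows that \<open>h x * exp (- x^2 / 2)\<close> and
    \<open>h0 x * exp (- x^2 / 2)\<close> have the same Fourier integral at every frequency, where \<open>h0\<close> is the
    inverse Fourier integral of \<open>G\<close>. Both are integrable, so \<open>h = h0\<close> almost everywhere. Uniqueness for
    integrable functions (\<open>fourier_uniqueness\<close>) is reduced to Levy's uniqueness theorem for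
    probability distributions by splitting into positive and negative parts.

  \<^item> Sampling (\<open>fourier_integral_sampling\<close>). On \<open>[-W, W]\<close>, where the exponentials
    \<open>\<xi> \<mapsto> exp (i n T \<xi>)\<close> are orthogonal, the coefficients of \<open>\<xi> \<mapsto> exp (i x \<xi>)\<close> are the numbers
    \<open>c n = sinc (x / T - n)\<close>. The squared \<open>L\<^sup>2\<close> distance to the partial sum over a finite set \<open>F\<close>
    is \<open>2 W (1 - (\<Sum>n\<in>F. (c n)^2))\<close>, which tends to 0 along the finite sets because the squares
    of the \<open>c n\<close> add up to 1 (\<open>has_sum_normalized_sinc_squared\<close>, a consequence of the reflection
    formula of the trigamma function). By the Cauchy-Schwarz inequality, integration against \<open>G\<close>
    gives the sampling series, with unconditional convergence.
\<close>

section \<open>Square-integrable functions\<close>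

lemma square_integrable_mult_integrable:
  assumes f: "square_integrable f" and g: "square_integrable g"
  shows "integrable lborel (\<lambda>x. f x * g x)"
proof (rule Bochner_Integration.integrable_bound)
  show "integrable lborel (\<lambda>x. (norm (f x))\<^sup>2 + (norm (g x))\<^sup>2)"
    using f g by (auto simp: square_integrable_def)
  show "(\<lambda>x. f x * g x) \<in> borel_measurable lborel"
    using f g by (auto simp: square_integrable_def)
  have "norm (f x * g x) \<le> norm ((norm (f x))\<^sup>2 + (norm (g x))\<^sup>2)" for x
    using sum_squares_bound[of "norm (f x)" "norm (g x)"]
      mult_nonneg_nonneg[of "norm (f x)" "norm (g x)"]
    by (simp add: norm_mult del: mult_nonneg_nonneg)
  then show "AE x in lborel. norm (f x * g x) \<le> norm ((norm (f x))\<^sup>2 + (norm (g x))\<^sup>2)" by simp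
qed

lemma cauchy_schwarz_integral:
  assumes f: "square_integrable f" and g: "square_integrable g"
  shows "(norm (LINT x|lborel. f x * g x))\<^sup>2
    \<le> (LINT x|lborel. (norm (f x))\<^sup>2) * (LINT x|lborel. (norm (g x))\<^sup>2)"
proof -
  define F where "F = (LINT x|lborel. (norm (f x))\<^sup>2)"
  define G where "G = (LINT x|lborel. (norm (g x))\<^sup>2)"
  define a where "a = (LINT x|lborel. norm (f x) * norm (g x))"
  have int: "integrable lborel (\<lambda>x. norm (f x) * norm (g x))"
    using integrable_norm[OF square_integrable_mult_integrable[OF f g]] by (simp add: norm_mult)
  have intf: "integrable lborel (\<lambda>x. (norm (f x))\<^sup>2)" and intg: "integrable lborel (\<lambda>x. (norm (g x))\<^sup>2)"
    using f g by (auto simp: square_integrable_def)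
  have G0: "G \<ge> 0" unfolding G_def by simp
  have quad: "0 \<le> F - 2 * t * a + t\<^sup>2 * G" for t
  proof -
    have "0 \<le> (LINT x|lborel. (norm (f x) - t * norm (g x))\<^sup>2)" by simp
    also have "\<dots> = (LINT x|lborel. (norm (f x))\<^sup>2 - 2 * t * (norm (f x) * norm (g x)) + t\<^sup>2 * (norm (g x))\<^sup>2)"
      by (intro Bochner_Integration.integral_cong) (auto simp: power2_eq_square algebra_simps)
    also have "\<dots> = F - 2 * t * a + t\<^sup>2 * G"
      using int intf intg by (simp add: F_def G_def a_def)
    finally show ?thesis .
  qed
  have "a\<^sup>2 \<le> F * G"
  proof (cases "G = 0")
    case True
    then have "AE x in lborel. (norm (g x))\<^sup>2 = 0"
      using integral_nonneg_eq_0_iff_AE[OF intg] by (simp add: G_def)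
    then have "AE x in lborel. norm (f x) * norm (g x) = 0" by eventually_elim simp
    then have "a = 0" unfolding a_def by (rule integral_eq_zero_AE)
    then show ?thesis using True by simp
  next
    case False
    then have "G > 0" using G0 by simp
    then show ?thesis using quad[of "a / G"] by (simp add: power2_eq_square field_simps)
  qed
  moreover have "norm (LINT x|lborel. f x * g x) \<le> a"
    using integral_norm_bound[of lborel "\<lambda>x. f x * g x"] by (simp add: a_def norm_mult)
  ultimately show ?thesis
    unfolding F_def[symmetric] G_def[symmetric]
    by (meson norm_ge_zero order_trans power_mono)
qed

lemma square_integrable_imp_integrable_Icc:
  assumes "square_integrable h"
  shows "integrable lborel (\<lambda>x. indicator {a..b} x *\<^sub>R h x)"
proof -
  have "square_integrable (\<lambda>x. indicator {a..b} x)"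
  proof -
    have "integrable lborel (\<lambda>x::real. indicator {a..b} x *\<^sub>R (1::real))"
      by (intro borel_integrable_compact) auto
    moreover have "(norm (indicator {a..b} x :: complex))\<^sup>2 = indicator {a..b} x" for x :: real
      by (auto simp: indicator_def)
    ultimately show ?thesis by (simp add: square_integrable_def)
  qed
  from square_integrable_mult_integrable[OF this assms] show ?thesis
    by (rule Bochner_Integration.integrable_cong[THEN iffD1, rotated -1]) (auto simp: indicator_def)
qed

text \<open>The hypothesis speaks of an extended nonnegative integral, so that square-integrability of the
  \<open>u n\<close> need not be assumed: it holds for all large \<open>n\<close>.\<close>

lemma tendsto_integral_mult_L2:
  fixes u :: "nat \<Rightarrow> real \<Rightarrow> complex"
  assumes meas: "\<And>n. u n \<in> borel_measurable lborel" and v: "square_integrable v"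
    and lim: "(\<lambda>n. \<integral>\<^sup>+x. ennreal ((norm (u n x))\<^sup>2) \<partial>lborel) \<longlonglongrightarrow> 0"
  shows "(\<lambda>n. LINT x|lborel. u n x * v x) \<longlonglongrightarrow> 0"
proof -
  define V where "V = (LINT x|lborel. (norm (v x))\<^sup>2)"
  have [measurable]: "u n \<in> borel_measurable borel" for n using meas by simp
  let ?N = "\<lambda>n. \<integral>\<^sup>+x. ennreal ((norm (u n x))\<^sup>2) \<partial>lborel"
  have fin: "eventually (\<lambda>n. ?N n < top) sequentially"
    using order_tendstoD(2)[OF lim, of top] by simp
  have "(\<lambda>n. enn2real (?N n)) \<longlonglongrightarrow> 0"
    by (rule tendsto_enn2real) (use lim in simp_all)
  then have "(\<lambda>n. sqrt (enn2real (?N n) * V)) \<longlonglongrightarrow> sqrt (0 * V)"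
    by (intro tendsto_real_sqrt tendsto_mult tendsto_const)
  then have lim0: "(\<lambda>n. sqrt (enn2real (?N n) * V)) \<longlonglongrightarrow> 0" by simp
  show ?thesis
  proof (rule Lim_null_comparison[OF _ lim0])
    show "eventually (\<lambda>n. norm (LINT x|lborel. u n x * v x) \<le> sqrt (enn2real (?N n) * V)) sequentially"
      using fin
    proof eventually_elim
      case (elim n)
      have "square_integrable (u n)"
        unfolding square_integrable_def using elim by (auto intro!: integrableI_bounded)
      moreover have "(LINT x|lborel. (norm (u n x))\<^sup>2) = enn2real (?N n)"
        by (rule integral_eq_nn_integral) auto
      ultimately show ?case
        using cauchy_schwarz_integral[OF _ v, of "u n"] by (auto simp: V_def intro!: real_le_rsqrt)
    qed
  qed
qed

section \<open>Fourier integrals of integrable functions\<close>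

text \<open>The Fourier integral with the sign \<open>+\<close> in the exponent and no normalising factor, so that the
  Fourier transform is its value at \<open>- t\<close> and the inverse transform is its value at \<open>t\<close>
  divided by \<open>2 \<pi>\<close>.\<close>

definition fourier_integral :: "(real \<Rightarrow> complex) \<Rightarrow> real \<Rightarrow> complex" where
  "fourier_integral w t = (LINT x|lborel. w x * iexp (t * x))"

lemma integrable_mult_iexp:
  fixes w :: "real \<Rightarrow> complex"
  assumes "integrable lborel w"
  shows "integrable lborel (\<lambda>x. w x * iexp (t * x))"
  using assms
  by (rule Bochner_Integration.integrable_bound) (use borel_measurable_integrable[OF assms] in \<open>auto simp: norm_mult\<close>)

lemma continuous_fourier_integral:
  assumes w: "integrable lborel w"
  shows "continuous_on UNIV (fourier_integral w)"
proof (intro continuous_at_imp_continuous_on ballI)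
  fix t
  have [measurable]: "w \<in> borel_measurable borel" using w by auto
  show "isCont (fourier_integral w) t"
    unfolding continuous_at_sequentially comp_def fourier_integral_def
  proof safe
    fix X assume X: "X \<longlonglongrightarrow> t"
    show "(\<lambda>n. LINT x|lborel. w x * iexp (X n * x)) \<longlonglongrightarrow> (LINT x|lborel. w x * iexp (t * x))"
      by (rule integral_dominated_convergence[where w="\<lambda>x. norm (w x)"])
         (use w in \<open>auto intro!: tendsto_intros X simp: norm_mult\<close>)
  qed
qed

lemma norm_fourier_integral_le:
  "norm (fourier_integral w t) \<le> (LINT x|lborel. norm (w x))"
  unfolding fourier_integral_def
  using integral_norm_bound[of lborel "\<lambda>x. w x * iexp (t * x)"] by (simp add: norm_mult)

lemma integrable_fourier_integral_mult:
  assumes w: "integrable lborel w" and v: "integrable lborel v"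
  shows "integrable lborel (\<lambda>t. fourier_integral w (s * t) * v t)"
proof (rule Bochner_Integration.integrable_bound)
  show "integrable lborel (\<lambda>t. of_real (LINT x|lborel. norm (w x)) * v t)" using v by simp
  have "continuous_on UNIV (\<lambda>t. fourier_integral w (s * t))"
    by (intro continuous_on_compose2[OF continuous_fourier_integral[OF w]] continuous_intros) auto
  then have [measurable]: "(\<lambda>t. fourier_integral w (s * t)) \<in> borel_measurable borel"
    by (rule borel_measurable_continuous_onI)
  show "(\<lambda>t. fourier_integral w (s * t) * v t) \<in> borel_measurable lborel"
    using v by measurable
  show "AE t in lborel. norm (fourier_integral w (s * t) * v t)
      \<le> norm (complex_of_real (LINT x|lborel. norm (w x)) * v t)"
    by (auto simp: norm_mult intro!: mult_right_mono norm_fourier_integral_le)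
qed

text \<open>The parameter \<open>s\<close> is there for the two signs of the exponent.\<close>

lemma fourier_multiplication_formula:
  assumes w: "integrable lborel w" and v: "integrable lborel v"
  shows "(LINT t|lborel. fourier_integral w (s * t) * v t) = (LINT x|lborel. w x * fourier_integral v (s * x))"
proof -
  have [measurable]: "w \<in> borel_measurable borel" "v \<in> borel_measurable borel" using w v by auto
  let ?f = "\<lambda>x t. w x * v t * iexp (s * x * t)"
  have int: "integrable (lborel \<Otimes>\<^sub>M lborel) (case_prod ?f)"
  proof (rule lborel_pair.Fubini_integrable)
    show "integrable lborel (\<lambda>x. LINT t|lborel. norm (case_prod ?f (x, t)))"
      using w by (simp add: norm_mult)
    have "integrable lborel (\<lambda>t. ?f x t)" for x
      using integrable_mult_iexp[OF v, of "s * x"] by (simp add: mult.assoc)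
    then show "AE x in lborel. integrable lborel (\<lambda>t. case_prod ?f (x, t))" by simp
  qed measurable
  have "(LINT t|lborel. LINT x|lborel. ?f x t) = (LINT x|lborel. LINT t|lborel. ?f x t)"
    by (rule lborel_pair.Fubini_integral[OF int])
  moreover have "(LINT x|lborel. ?f x t) = fourier_integral w (s * t) * v t" for t
    unfolding fourier_integral_def integral_mult_left_zero[symmetric]
    by (intro Bochner_Integration.integral_cong) (simp_all add: mult_ac)
  moreover have "(LINT t|lborel. ?f x t) = w x * fourier_integral v (s * x)" for x
    unfolding fourier_integral_def integral_mult_right_zero[symmetric]
    by (intro Bochner_Integration.integral_cong) (simp_all add: mult_ac)
  ultimately show ?thesis by simp
qed

section \<open>Uniqueness of the Fourier integral\<close>

text \<open>The vanishing Fourier integral at 0 gives the positive and negative parts of \<open>u\<close> the same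
  mass \<open>m\<close>. Unless \<open>m = 0\<close>, division by \<open>m\<close> makes them probability densities with the same characteristic
  function.\<close>

lemma fourier_uniqueness_real:
  fixes u :: "real \<Rightarrow> real"
  assumes u: "integrable lborel u"
    and zero: "\<And>t. (LINT x|lborel. of_real (u x) * iexp (t * x)) = 0"
  shows "AE x in lborel. u x = 0"
proof -
  define pp where "pp = (\<lambda>x. max 0 (u x))"
  define nn where "nn = (\<lambda>x. max 0 (- u x))"
  have ipp: "integrable lborel pp" and inn: "integrable lborel nn"
    using u unfolding pp_def nn_def by auto
  have pos: "pp x \<ge> 0" "nn x \<ge> 0" and udiff: "u x = pp x - nn x" for x
    by (auto simp: pp_def nn_def)
  have eqF: "(LINT x|lborel. of_real (pp x) * iexp (t * x)) = (LINT x|lborel. of_real (nn x) * iexp (t * x))" for t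
  proof -
    have "(LINT x|lborel. of_real (pp x) * iexp (t * x)) - (LINT x|lborel. of_real (nn x) * iexp (t * x))
       = (LINT x|lborel. of_real (pp x) * iexp (t * x) - of_real (nn x) * iexp (t * x))"
      using ipp inn by (intro Bochner_Integration.integral_diff[symmetric] integrable_mult_iexp) auto
    also have "\<dots> = 0" using zero[of t] by (simp add: udiff algebra_simps)
    finally show ?thesis by simp
  qed
  define m where "m = (LINT x|lborel. pp x)"
  have m2: "m = (LINT x|lborel. nn x)"
    using eqF[of 0] by (simp add: m_def)
  have m0: "m \<ge> 0" unfolding m_def using pos by simp
  have "AE x in lborel. pp x = nn x"
  proof (cases "m = 0")
    case True
    have "AE x in lborel. pp x = 0"
      using integral_nonneg_eq_0_iff_AE[OF ipp] pos True by (simp add: m_def)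
    moreover have "AE x in lborel. nn x = 0"
      using integral_nonneg_eq_0_iff_AE[OF inn] pos True by (simp add: m2)
    ultimately show ?thesis by eventually_elim simp
  next
    case False
    then have m: "m > 0" using m0 by simp
    have dist: "real_distribution (density lborel (\<lambda>x. ennreal (v x / m)))"
      if v: "integrable lborel v" "\<And>x. v x \<ge> 0" "(LINT x|lborel. v x) = m" for v
    proof -
      have [measurable]: "v \<in> borel_measurable borel" using v(1) by auto
      have "(\<integral>\<^sup>+x. ennreal (v x / m) \<partial>lborel) = ennreal (LINT x|lborel. v x / m)"
        using v m by (intro nn_integral_eq_integral) auto
      also have "\<dots> = 1" using v m by simp
      finally have "prob_space (density lborel (\<lambda>x. ennreal (v x / m)))"
        by (intro prob_spaceI) (simp add: emeasure_density)
      then show ?thesis by (simp add: real_distribution_def real_distribution_axioms_def)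
    qed
    have ch: "char (density lborel (\<lambda>x. ennreal (v x / m))) t = (LINT x|lborel. of_real (v x) * iexp (t * x)) / m"
      if v: "integrable lborel v" "\<And>x. v x \<ge> 0" for v t
    proof -
      have [measurable]: "v \<in> borel_measurable borel" using v(1) by auto
      have "char (density lborel (\<lambda>x. ennreal (v x / m))) t = (LINT x|lborel. (v x / m) *\<^sub>R iexp (t * x))"
        unfolding char_def using v m by (intro integral_density) auto
      also have "\<dots> = (LINT x|lborel. (of_real (v x) * iexp (t * x)) / m)"
        by (intro Bochner_Integration.integral_cong) (auto simp: scaleR_conv_of_real)
      finally show ?thesis by simp
    qed
    have [measurable]: "pp \<in> borel_measurable borel" "nn \<in> borel_measurable borel"
      using ipp inn by auto
    have "char (density lborel (\<lambda>x. ennreal (pp x / m))) = char (density lborel (\<lambda>x. ennreal (nn x / m)))"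
      by (rule ext) (simp only: ch[OF ipp pos(1)] ch[OF inn pos(2)] eqF)
    then have "density lborel (\<lambda>x. ennreal (pp x / m)) = density lborel (\<lambda>x. ennreal (nn x / m))"
      using ipp inn pos m_def m2 by (intro Levy_uniqueness dist) auto
    then have "AE x in lborel. ennreal (pp x / m) = ennreal (nn x / m)"
      by (intro sigma_finite_measure.density_unique[OF sigma_finite_lborel]) auto
    then show ?thesis
      by (rule AE_mp) (use pos m in auto)
  qed
  then show ?thesis by eventually_elim (simp add: udiff)
qed

lemma fourier_uniqueness:
  fixes w :: "real \<Rightarrow> complex"
  assumes w: "integrable lborel w"
    and "\<And>t. fourier_integral w t = 0"
  shows "AE x in lborel. w x = 0"
proof -
  have zero: "(LINT x|lborel. w x * iexp (t * x)) = 0" for t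
    using assms(2) by (simp add: fourier_integral_def)
  \<comment> \<open>The hypothesis at \<open>- t\<close>, conjugated; with it the real and imaginary parts can be separated.\<close>
  have zero': "(LINT x|lborel. cnj (w x) * iexp (t * x)) = 0" for t
  proof -
    have "(LINT x|lborel. cnj (w x) * iexp (t * x)) = (LINT x|lborel. cnj (w x * iexp ((-t) * x)))"
      by (intro Bochner_Integration.integral_cong) (auto simp: exp_cnj)
    also have "\<dots> = cnj (LINT x|lborel. w x * iexp ((-t) * x))" by (rule Bochner_Integration.integral_cnj)
    also have "\<dots> = 0" by (simp only: zero complex_cnj_zero)
    finally show ?thesis .
  qed
  note i1 = integrable_mult_iexp[OF w]
  have i2: "integrable lborel (\<lambda>x. cnj (w x) * iexp (t * x))" for t
    using w by (intro integrable_mult_iexp) simp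
  have re: "AE x in lborel. Re (w x) = 0"
  proof (rule fourier_uniqueness_real)
    fix t
    have "(LINT x|lborel. of_real (Re (w x)) * iexp (t * x))
      = (LINT x|lborel. (w x * iexp (t * x) + cnj (w x) * iexp (t * x)) / 2)"
    proof (intro Bochner_Integration.integral_cong refl)
      fix x
      have "of_real (Re (w x)) = (w x + cnj (w x)) / 2" by (simp add: complex_eq_iff)
      then show "of_real (Re (w x)) * iexp (t * x) = (w x * iexp (t * x) + cnj (w x) * iexp (t * x)) / 2"
        by (simp only: times_divide_eq_left distrib_right)
    qed
    also have "\<dots> = 0" using i1 i2 zero zero' by simp
    finally show "(LINT x|lborel. of_real (Re (w x)) * iexp (t * x)) = 0" .
  qed (use w in simp)
  have im: "AE x in lborel. Im (w x) = 0"
  proof (rule fourier_uniqueness_real)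
    fix t
    have "(LINT x|lborel. of_real (Im (w x)) * iexp (t * x))
      = (LINT x|lborel. (w x * iexp (t * x) - cnj (w x) * iexp (t * x)) / (2 * \<i>))"
    proof (intro Bochner_Integration.integral_cong refl)
      fix x
      have "of_real (Im (w x)) = (w x - cnj (w x)) / (2 * \<i>)" by (simp add: complex_eq_iff)
      then show "of_real (Im (w x)) * iexp (t * x) = (w x * iexp (t * x) - cnj (w x) * iexp (t * x)) / (2 * \<i>)"
        by (simp only: times_divide_eq_left left_diff_distrib)
    qed
    also have "\<dots> = 0" using i1 i2 zero zero' by simp
    finally show "(LINT x|lborel. of_real (Im (w x)) * iexp (t * x)) = 0" .
  qed (use w in simp)
  from re im show ?thesis by eventually_elim (simp add: complex_eq_iff)
qed

section \<open>Gaussians\<close>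

lemma integrable_gaussian: "integrable lborel (\<lambda>x::real. exp (- ((x - a)\<^sup>2) / 2))"
proof -
  have "integrable lborel (\<lambda>x. sqrt (2 * pi) * normal_density a 1 x)"
    by (intro integrable_mult_right integrable_normal_density) simp
  then show ?thesis by (simp add: normal_density_def)
qed

lemma fourier_gaussian:
  "fourier_integral (\<lambda>x. of_real (exp (- (x\<^sup>2) / 2))) t = of_real (sqrt (2 * pi) * exp (- (t\<^sup>2) / 2))"
proof -
  have "complex_of_real (exp (- (t\<^sup>2) / 2)) = char std_normal_distribution t"
    by (simp add: char_std_normal_distribution)
  also have "\<dots> = (LINT x|lborel. std_normal_density x *\<^sub>R iexp (t * x))"
    unfolding char_def by (intro integral_density) (auto simp: normal_density_nonneg)
  also have "\<dots> = (LINT x|lborel. of_real (1 / sqrt (2 * pi)) * (of_real (exp (- (x\<^sup>2) / 2)) * iexp (t * x)))"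
    by (intro Bochner_Integration.integral_cong) (auto simp: std_normal_density_def scaleR_conv_of_real)
  also have "\<dots> = of_real (1 / sqrt (2 * pi)) * (LINT x|lborel. of_real (exp (- (x\<^sup>2) / 2)) * iexp (t * x))"
    by (rule integral_mult_right_zero)
  finally show ?thesis by (simp add: fourier_integral_def field_simps)
qed

lemma fourier_gaussian_shifted:
  "fourier_integral (\<lambda>x. of_real (exp (- ((x - a)\<^sup>2) / 2))) t
    = of_real (sqrt (2 * pi) * exp (- (t\<^sup>2) / 2)) * iexp (t * a)"
proof -
  have "fourier_integral (\<lambda>x. of_real (exp (- ((x - a)\<^sup>2) / 2))) t
      = (LINT x|lborel. of_real (exp (- (x\<^sup>2) / 2)) * iexp (t * x) * iexp (t * a))"
    unfolding fourier_integral_def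
    by (subst lborel_integral_real_affine[of 1 _ a])
       (auto intro!: Bochner_Integration.integral_cong simp: exp_add[symmetric] algebra_simps)
  also have "\<dots> = fourier_integral (\<lambda>x. of_real (exp (- (x\<^sup>2) / 2))) t * iexp (t * a)"
    unfolding fourier_integral_def by (rule integral_mult_left_zero)
  finally show ?thesis by (simp only: fourier_gaussian)
qed

lemma fourier_gaussian_modulated:
  "fourier_integral (\<lambda>x. of_real (exp (- (x\<^sup>2) / 2)) * iexp (b * x)) t
    = of_real (sqrt (2 * pi) * exp (- ((t + b)\<^sup>2) / 2))"
proof -
  have "fourier_integral (\<lambda>x. of_real (exp (- (x\<^sup>2) / 2)) * iexp (b * x)) t
      = fourier_integral (\<lambda>x. of_real (exp (- (x\<^sup>2) / 2))) (t + b)"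
    unfolding fourier_integral_def
    by (intro Bochner_Integration.integral_cong) (auto simp: exp_add[symmetric] algebra_simps)
  then show ?thesis by (simp only: fourier_gaussian)
qed

lemma square_integrable_gaussian:
  "square_integrable (\<lambda>x. of_real (exp (- ((x - a)\<^sup>2) / 2)))"
proof -
  have "integrable lborel (\<lambda>x::real. (exp (- ((x - a)\<^sup>2) / 2))\<^sup>2)"
  proof (rule Bochner_Integration.integrable_bound[OF integrable_gaussian[of a]])
    show "AE x in lborel. norm ((exp (- ((x - a)\<^sup>2) / 2))\<^sup>2) \<le> norm (exp (- ((x - a)\<^sup>2) / 2))"
      by (auto simp: power2_eq_square intro!: mult_left_le)
  qed measurable
  then show ?thesis by (simp add: square_integrable_def)
qed

section \<open>Fourier inversion for square-integrable functions\<close>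

lemma fourier_inversion_L2:
  assumes h: "square_integrable h" and G: "square_integrable G" and Gi: "integrable lborel G"
    and lim: "((\<lambda>R. \<integral>\<^sup>+\<xi>. ennreal ((norm (fourier_integral (\<lambda>x. indicator {-R..R} x *\<^sub>R h x) (-\<xi>) - G \<xi>))\<^sup>2) \<partial>lborel)
      \<longlongrightarrow> 0) at_top"
  shows "AE x in lborel. h x = fourier_integral G x / (2 * pi)"
proof -
  define hR where "hR = (\<lambda>(n::nat) x. indicator {- real n..real n} x *\<^sub>R h x)"
  define gs where "gs = (\<lambda>a (x::real). complex_of_real (exp (- ((x - a)\<^sup>2) / 2)))"
  define h0 where "h0 = (\<lambda>x. fourier_integral G x / (2 * pi))"
  have [measurable]: "h \<in> borel_measurable borel" "G \<in> borel_measurable borel"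
    using h G by (auto simp: square_integrable_def)
  have hRi: "integrable lborel (hR n)" for n
    unfolding hR_def by (rule square_integrable_imp_integrable_Icc[OF h])
  have gsi: "integrable lborel (gs a)" for a
    unfolding gs_def using integrable_gaussian[of a] by simp
  have gs2: "square_integrable (gs a)" for a unfolding gs_def by (rule square_integrable_gaussian)
  have [measurable]: "gs a \<in> borel_measurable borel" for a using gsi by auto
  have hgi: "integrable lborel (\<lambda>x. h x * gs 0 x)"
    by (rule square_integrable_mult_integrable[OF h gs2])
  have FG: "fourier_integral (gs a) t = of_real (sqrt (2 * pi)) * (gs 0 t * iexp (t * a))" for a t
    unfolding gs_def using fourier_gaussian_shifted[of a t] by simp
  have gs_even: "gs 0 (- x) = gs 0 x" for x by (simp add: gs_def)
  have meas_fi: "(\<lambda>\<xi>. fourier_integral (hR n) (-\<xi>)) \<in> borel_measurable borel" for n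
    by (intro borel_measurable_continuous_onI continuous_on_compose2[OF continuous_fourier_integral[OF hRi]]
          continuous_intros) auto
  \<comment> \<open>Gaussian averages of \<open>G\<close> are Fourier integrals of \<open>h\<close> times a Gaussian, by passing to the
    limit in the multiplication formula for the truncations \<open>hR n\<close>.\<close>
  have average_h: "(LINT \<xi>|lborel. G \<xi> * gs a \<xi>) = of_real (sqrt (2 * pi)) * (LINT x|lborel. h x * gs 0 x * iexp (- a * x))" for a
  proof -
    have "(\<lambda>n. LINT \<xi>|lborel. (fourier_integral (hR n) (-\<xi>) - G \<xi>) * gs a \<xi>) \<longlonglongrightarrow> 0"
    proof (rule tendsto_integral_mult_L2)
      show "(\<lambda>n. \<integral>\<^sup>+\<xi>. ennreal ((norm (fourier_integral (hR n) (-\<xi>) - G \<xi>))\<^sup>2) \<partial>lborel) \<longlonglongrightarrow> 0"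
        using filterlim_compose[OF lim filterlim_real_sequentially] by (simp add: hR_def)
    qed (use meas_fi gs2 in auto)
    moreover have "(LINT \<xi>|lborel. (fourier_integral (hR n) (-\<xi>) - G \<xi>) * gs a \<xi>)
        = (LINT x|lborel. hR n x * fourier_integral (gs a) (- x)) - (LINT \<xi>|lborel. G \<xi> * gs a \<xi>)" for n
    proof -
      have "(LINT \<xi>|lborel. (fourier_integral (hR n) (-\<xi>) - G \<xi>) * gs a \<xi>)
          = (LINT \<xi>|lborel. fourier_integral (hR n) (-1 * \<xi>) * gs a \<xi>) - (LINT \<xi>|lborel. G \<xi> * gs a \<xi>)"
        unfolding left_diff_distrib
        using integrable_fourier_integral_mult[OF hRi gsi, of n "-1" a] square_integrable_mult_integrable[OF G gs2]
        by (subst Bochner_Integration.integral_diff) auto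
      then show ?thesis using fourier_multiplication_formula[OF hRi gsi, of n "-1" a] by simp
    qed
    ultimately have l1: "(\<lambda>n. (LINT x|lborel. hR n x * fourier_integral (gs a) (- x)) - (LINT \<xi>|lborel. G \<xi> * gs a \<xi>)) \<longlonglongrightarrow> 0"
      by simp
    have "(\<lambda>n. LINT x|lborel. hR n x * fourier_integral (gs a) (- x)) \<longlonglongrightarrow> (LINT x|lborel. h x * fourier_integral (gs a) (- x))"
    proof (rule integral_dominated_convergence[where w="\<lambda>x. norm (of_real (sqrt (2 * pi)) * (h x * gs 0 x))"])
      show "integrable lborel (\<lambda>x. norm (of_real (sqrt (2 * pi)) * (h x * gs 0 x)))"
        using hgi by (intro integrable_norm integrable_mult_right) auto
      show "AE x in lborel. (\<lambda>n. hR n x * fourier_integral (gs a) (- x)) \<longlonglongrightarrow> h x * fourier_integral (gs a) (- x)"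
      proof (intro AE_I2 tendsto_mult tendsto_const)
        fix x
        obtain N :: nat where "\<bar>x\<bar> \<le> real N" using real_arch_simple by blast
        then have "hR n x = h x" if "n \<ge> N" for n
          using that by (auto simp: hR_def indicator_def)
        then show "(\<lambda>n. hR n x) \<longlonglongrightarrow> h x"
          by (intro tendsto_eventually) (auto simp: eventually_sequentially)
      qed
      show "AE x in lborel. norm (hR n x * fourier_integral (gs a) (- x)) \<le> norm (of_real (sqrt (2 * pi)) * (h x * gs 0 x))" for n
        unfolding FG by (auto simp: hR_def norm_mult indicator_def gs_even)
    qed (auto simp: FG hR_def)
    then have "(\<lambda>n. (LINT x|lborel. hR n x * fourier_integral (gs a) (- x)) - (LINT \<xi>|lborel. G \<xi> * gs a \<xi>))
      \<longlonglongrightarrow> (LINT x|lborel. h x * fourier_integral (gs a) (- x)) - (LINT \<xi>|lborel. G \<xi> * gs a \<xi>)"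
      by (intro tendsto_intros)
    from LIMSEQ_unique[OF l1 this]
    have "(LINT \<xi>|lborel. G \<xi> * gs a \<xi>) = (LINT x|lborel. h x * fourier_integral (gs a) (- x))" by simp
    also have "\<dots> = (LINT x|lborel. of_real (sqrt (2 * pi)) * (h x * gs 0 x * iexp (- a * x)))"
      by (intro Bochner_Integration.integral_cong) (simp_all add: FG gs_even mult_ac)
    also have "\<dots> = of_real (sqrt (2 * pi)) * (LINT x|lborel. h x * gs 0 x * iexp (- a * x))"
      by (rule integral_mult_right_zero)
    finally show ?thesis .
  qed
  have h0gi: "integrable lborel (\<lambda>x. h0 x * gs 0 x)"
    using integrable_fourier_integral_mult[OF Gi gsi, of 1 0] by (simp add: h0_def)
  \<comment> \<open>The same identity for \<open>h0\<close>, where the multiplication formula applies directly because \<open>G\<close>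
    is integrable.\<close>
  have average_h0: "(LINT \<xi>|lborel. G \<xi> * gs a \<xi>) = of_real (sqrt (2 * pi)) * (LINT x|lborel. h0 x * gs 0 x * iexp (- a * x))" for a
  proof -
    define m where "m = (\<lambda>x. gs 0 x * iexp (- a * x))"
    have mi: "integrable lborel m" unfolding m_def by (rule integrable_mult_iexp[OF gsi])
    have Fm: "fourier_integral m t = of_real (sqrt (2 * pi)) * gs a t" for t
      using fourier_gaussian_modulated[of "-a" t] by (simp add: m_def gs_def)
    have "(LINT x|lborel. h0 x * gs 0 x * iexp (- a * x)) = (LINT x|lborel. (fourier_integral G (1 * x) * m x) / (2 * pi))"
      by (intro Bochner_Integration.integral_cong) (simp_all add: h0_def m_def)
    also have "\<dots> = (LINT x|lborel. fourier_integral G (1 * x) * m x) / (2 * pi)" by simp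
    also have "\<dots> = (LINT \<xi>|lborel. G \<xi> * fourier_integral m (1 * \<xi>)) / (2 * pi)"
      by (simp only: fourier_multiplication_formula[OF Gi mi])
    also have "(LINT \<xi>|lborel. G \<xi> * fourier_integral m (1 * \<xi>)) = (LINT \<xi>|lborel. of_real (sqrt (2 * pi)) * (G \<xi> * gs a \<xi>))"
      by (intro Bochner_Integration.integral_cong) (simp_all add: Fm mult_ac)
    also have "\<dots> = of_real (sqrt (2 * pi)) * (LINT \<xi>|lborel. G \<xi> * gs a \<xi>)"
      by (rule integral_mult_right_zero)
    finally have X: "(LINT x|lborel. h0 x * gs 0 x * iexp (- a * x))
      = of_real (sqrt (2 * pi)) * (LINT \<xi>|lborel. G \<xi> * gs a \<xi>) / (2 * pi)" .
    have "of_real (sqrt (2 * pi)) * of_real (sqrt (2 * pi)) = complex_of_real (2 * pi)"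
      by (simp flip: of_real_mult)
    then show ?thesis unfolding X by (simp add: mult.assoc[symmetric] del: of_real_mult)
  qed
  have "AE x in lborel. h x * gs 0 x - h0 x * gs 0 x = 0"
  proof (rule fourier_uniqueness)
    show "integrable lborel (\<lambda>x. h x * gs 0 x - h0 x * gs 0 x)" using hgi h0gi by simp
    fix t
    have "fourier_integral (\<lambda>x. h x * gs 0 x - h0 x * gs 0 x) t
      = (LINT x|lborel. h x * gs 0 x * iexp (- (- t) * x) - h0 x * gs 0 x * iexp (- (- t) * x))"
      by (simp add: fourier_integral_def left_diff_distrib)
    also have "\<dots> = (LINT x|lborel. h x * gs 0 x * iexp (- (- t) * x)) - (LINT x|lborel. h0 x * gs 0 x * iexp (- (- t) * x))"
      by (intro Bochner_Integration.integral_diff integrable_mult_iexp hgi h0gi)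
    also have "\<dots> = 0"
    proof -
      have "of_real (sqrt (2 * pi)) * (LINT x|lborel. h x * gs 0 x * iexp (- (- t) * x))
        = of_real (sqrt (2 * pi)) * (LINT x|lborel. h0 x * gs 0 x * iexp (- (- t) * x))"
        unfolding average_h[symmetric] average_h0[symmetric] ..
      then show ?thesis by simp
    qed
    finally show "fourier_integral (\<lambda>x. h x * gs 0 x - h0 x * gs 0 x) t = 0" .
  qed
  then have "AE x in lborel. h x = h0 x"
    by eventually_elim (auto simp: gs_def)
  then show ?thesis by (simp add: h0_def)
qed

section \<open>The squares of the shifted sinc values\<close>

text \<open>Twice differentiate the logarithm of \<open>\<Gamma>(x) \<Gamma>(1 - x) = \<pi> / sin (\<pi> x)\<close>.\<close>

lemma trigamma_reflection:
  fixes x :: real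
  assumes "0 < x" "x < 1"
  shows "Polygamma 1 x + Polygamma 1 (1 - x) = pi\<^sup>2 / (sin (pi * x))\<^sup>2"
proof -
  have sinpos: "sin (pi * y) > 0" if "0 < y" "y < 1" for y :: real
    using that by (intro sin_gt_zero) auto
  have refl: "ln_Gamma y + ln_Gamma (1 - y) = ln pi - ln (sin (pi * y))" if y: "0 < y" "y < 1" for y :: real
  proof -
    have "complex_of_real (Gamma y * Gamma (1 - y)) = of_real (pi / sin (pi * y))"
      using Gamma_reflection_complex[of "of_real y"]
      by (simp flip: Gamma_complex_of_real sin_of_real)
    then have "Gamma y * Gamma (1 - y) = pi / sin (pi * y)" using of_real_eq_iff by blast
    then have "exp (ln_Gamma y + ln_Gamma (1 - y)) = exp (ln pi - ln (sin (pi * y)))"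
      using y sinpos[OF y] by (simp add: Gamma_real_pos_exp exp_add exp_diff)
    then show ?thesis by simp
  qed
  have dig: "Digamma y - Digamma (1 - y) = - (pi * cos (pi * y) / sin (pi * y))" if y: "0 < y" "y < 1" for y :: real
  proof -
    have d1: "((\<lambda>y. ln_Gamma y + ln_Gamma (1 - y)) has_real_derivative Digamma y - Digamma (1 - y)) (at y)"
      using y by (auto intro!: derivative_eq_intros)
    have d2: "((\<lambda>y. ln pi - ln (sin (pi * y))) has_real_derivative - (pi * cos (pi * y) / sin (pi * y))) (at y)"
      using y sinpos[OF y] by (auto intro!: derivative_eq_intros)
    have "((\<lambda>y. ln_Gamma y + ln_Gamma (1 - y)) has_real_derivative - (pi * cos (pi * y) / sin (pi * y))) (at y)"
      by (rule has_field_derivative_transform_within_open[OF d2, of "{0<..<1}"]) (use y refl in auto)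
    from DERIV_unique[OF d1 this] show ?thesis .
  qed
  have nz: "x \<notin> \<int>\<^sub>\<le>\<^sub>0" "1 - x \<notin> \<int>\<^sub>\<le>\<^sub>0" using assms by (auto elim!: nonpos_Ints_cases)
  have d1: "((\<lambda>y. Digamma y - Digamma (1 - y)) has_real_derivative Polygamma 1 x + Polygamma 1 (1 - x)) (at x)"
    using nz by (auto intro!: derivative_eq_intros)
  have "((\<lambda>y. - (pi * cos (pi * y) / sin (pi * y))) has_real_derivative
      pi\<^sup>2 * ((sin (pi * x))\<^sup>2 + (cos (pi * x))\<^sup>2) / (sin (pi * x))\<^sup>2) (at x)"
    using sinpos[OF assms]
    by (auto intro!: derivative_eq_intros simp: power2_eq_square algebra_simps add_divide_distrib diff_divide_distrib simp del: sin_cos_squared_add3)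
  then have d2: "((\<lambda>y. - (pi * cos (pi * y) / sin (pi * y))) has_real_derivative pi\<^sup>2 / (sin (pi * x))\<^sup>2) (at x)"
    by simp
  have "((\<lambda>y. Digamma y - Digamma (1 - y)) has_real_derivative pi\<^sup>2 / (sin (pi * x))\<^sup>2) (at x)"
    by (rule has_field_derivative_transform_within_open[OF d2, of "{0<..<1}"]) (use assms dig in auto)
  from DERIV_unique[OF d1 this] show ?thesis .
qed

lemma trigamma_has_sum:
  fixes x :: real
  assumes "x > 0"
  shows "((\<lambda>k::nat. 1 / (x + real k)\<^sup>2) has_sum Polygamma 1 x) UNIV"
proof (rule sums_nonneg_imp_has_sum)
  have nz: "x \<noteq> 0" using assms by simp
  have "summable (\<lambda>k. inverse ((x + of_nat k) ^ 2))"
    using Polygamma_converges'[OF nz, of 2] by simp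
  then have "(\<lambda>k. inverse ((x + of_nat k) ^ 2)) sums (\<Sum>k. inverse ((x + of_nat k) ^ 2))"
    by (rule summable_sums)
  moreover have "(\<Sum>k. inverse ((x + of_nat k) ^ 2)) = Polygamma 1 x"
    by (simp add: Polygamma_def numeral_2_eq_2)
  ultimately show "(\<lambda>k. 1 / (x + real k)\<^sup>2) sums Polygamma 1 x"
    by (simp add: inverse_eq_divide)
qed auto

text \<open>The terms with \<open>n \<le> 0\<close> give the trigamma series at \<open>x\<close>, those with \<open>n \<ge> 1\<close> the one at
  \<open>1 - x\<close>.\<close>

lemma has_sum_inverse_squares_int:
  fixes x :: real
  assumes x: "0 < x" "x < 1"
  shows "((\<lambda>n::int. 1 / (x - of_int n)\<^sup>2) has_sum pi\<^sup>2 / (sin (pi * x))\<^sup>2) UNIV"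
proof -
  have a: "((\<lambda>n::int. 1 / (x - of_int n)\<^sup>2) has_sum Polygamma 1 x) ((\<lambda>k::nat. - int k) ` UNIV)"
    using trigamma_has_sum[OF x(1)] by (subst has_sum_reindex) (auto simp: inj_on_def o_def)
  have eq: "(x - real_of_int (int k + 1))\<^sup>2 = (1 - x + real k)\<^sup>2" for k
    by (simp add: power2_eq_square algebra_simps)
  have b: "((\<lambda>n::int. 1 / (x - of_int n)\<^sup>2) has_sum Polygamma 1 (1 - x)) ((\<lambda>k::nat. int k + 1) ` UNIV)"
    using trigamma_has_sum[of "1 - x"] x by (subst has_sum_reindex) (auto simp: inj_on_def o_def eq simp del: of_int_add)
  have un: "(\<lambda>k::nat. - int k) ` UNIV \<union> (\<lambda>k::nat. int k + 1) ` UNIV = UNIV"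
  proof (rule UNIV_eq_I[symmetric])
    fix n :: int
    show "n \<in> (\<lambda>k::nat. - int k) ` UNIV \<union> (\<lambda>k::nat. int k + 1) ` UNIV"
    proof (cases "n \<le> 0")
      case True
      then have "n = - int (nat (- n))" by simp
      then show ?thesis by blast
    next
      case False
      then have "n = int (nat (n - 1)) + 1" by simp
      then show ?thesis by blast
    qed
  qed
  have "((\<lambda>n::int. 1 / (x - of_int n)\<^sup>2) has_sum (Polygamma 1 x + Polygamma 1 (1 - x))) UNIV"
    using has_sum_Un_disjoint[OF a b] unfolding un by fastforce
  then show ?thesis using trigamma_reflection[OF x] by simp
qed

lemma normalized_sinc_of_int: "normalized_sinc (of_int m) = (if m = 0 then 1 else 0)"
  by (auto simp: normalized_sinc_def mult.commute sin_zero_iff_int2)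

lemma normalized_sinc_minus: "normalized_sinc (- x) = normalized_sinc x"
  by (simp add: normalized_sinc_def)

lemma has_sum_normalized_sinc_squared:
  "((\<lambda>n::int. (normalized_sinc (s - of_int n))\<^sup>2) has_sum 1) UNIV"
proof -
  \<comment> \<open>The family is only reindexed when \<open>s\<close> is shifted by an integer.\<close>
  have shift: "((\<lambda>n::int. (normalized_sinc (frac s - of_int n))\<^sup>2) has_sum 1) UNIV"
  proof (cases "frac s = 0")
    case True
    have "((\<lambda>n::int. if n = 0 then 1 else (0::real)) has_sum 1) {0}"
      using has_sum_finite[of "{0::int}" "\<lambda>n. if n = 0 then 1 else (0::real)"] by simp
    then have "((\<lambda>n::int. if n = 0 then 1 else (0::real)) has_sum 1) UNIV"
      by (rule has_sum_cong_neutral[THEN iffD1, rotated -1]) auto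
    moreover have "(normalized_sinc (frac s - of_int n))\<^sup>2 = (if n = 0 then 1 else 0)" for n
      unfolding True by (simp add: normalized_sinc_minus normalized_sinc_of_int)
    ultimately show ?thesis by simp
  next
    case False
    define x where "x = frac s"
    have x: "0 < x" "x < 1" using False frac_lt_1[of s] frac_ge_0[of s] by (auto simp: x_def less_le)
    have sn: "sin (pi * x) > 0" using x by (intro sin_gt_zero) auto
    have "((\<lambda>n::int. (sin (pi * x))\<^sup>2 / pi\<^sup>2 * (1 / (x - of_int n)\<^sup>2)) has_sum
       (sin (pi * x))\<^sup>2 / pi\<^sup>2 * (pi\<^sup>2 / (sin (pi * x))\<^sup>2)) UNIV"
      by (intro has_sum_cmult_right has_sum_inverse_squares_int x)
    moreover have "(normalized_sinc (x - of_int n))\<^sup>2 = (sin (pi * x))\<^sup>2 / pi\<^sup>2 * (1 / (x - of_int n)\<^sup>2)" for n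
    proof -
      have "x - of_int n \<noteq> 0"
      proof
        assume "x - of_int n = 0"
        then have "0 < n" "n < 1" using x by auto
        then show False by simp
      qed
      moreover have "(sin (pi * (x - of_int n)))\<^sup>2 = (sin (pi * x))\<^sup>2"
      proof -
        have "sin (of_int n * pi) = 0" by (simp add: sin_zero_iff_int2)
        then have "(cos (of_int n * pi))\<^sup>2 = 1" using sin_cos_squared_add[of "of_int n * pi"] by simp
        then show ?thesis using \<open>sin (of_int n * pi) = 0\<close>
          by (simp add: right_diff_distrib sin_diff power_mult_distrib mult.commute[of pi "of_int n"])
      qed
      ultimately show ?thesis by (simp add: normalized_sinc_def power_divide power_mult_distrib)
    qed
    ultimately show ?thesis using sn by (simp add: x_def)
  qed
  have "bij_betw (\<lambda>n. n - \<lfloor>s\<rfloor>) UNIV UNIV"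
    by (rule bij_betwI[of _ _ _ "\<lambda>n. n + \<lfloor>s\<rfloor>"]) auto
  from has_sum_reindex_bij_betw[OF this, THEN iffD2, OF shift] show ?thesis
    by (simp add: frac_def)
qed

section \<open>The sampling theorem for Fourier integrals\<close>

lemma integral_cos_interval:
  fixes a W :: real
  assumes W: "W > 0"
  shows "((\<lambda>\<xi>. cos (a * \<xi>)) has_integral 2 * W * normalized_sinc (a * W / pi)) {-W..W}"
proof (cases "a = 0")
  case True
  then show ?thesis using W has_integral_const_real[of "1::real" "-W" W] by (simp add: normalized_sinc_def)
next
  case False
  have "((\<lambda>\<xi>. cos (a * \<xi>)) has_integral (sin (a * W) / a - sin (a * (-W)) / a)) {-W..W}"
    using W False
    by (intro fundamental_theorem_of_calculus)
       (auto simp: has_real_derivative_iff_has_vector_derivative[symmetric] intro!: derivative_eq_intros)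
  moreover have "sin (a * W) / a - sin (a * (-W)) / a = 2 * W * normalized_sinc (a * W / pi)"
    using False W by (simp add: normalized_sinc_def field_simps)
  ultimately show ?thesis by simp
qed

lemma norm_iexp_minus_sum_squared:
  fixes c t :: "'i \<Rightarrow> real"
  shows "(norm (iexp (x * \<xi>) - (\<Sum>n\<in>F. of_real (c n) * iexp (t n * \<xi>))))\<^sup>2
    = 1 - 2 * (\<Sum>n\<in>F. c n * cos ((x - t n) * \<xi>)) + (\<Sum>n\<in>F. \<Sum>m\<in>F. c n * c m * cos ((t n - t m) * \<xi>))"
proof -
  let ?C = "\<Sum>n\<in>F. c n * cos (t n * \<xi>)" and ?S = "\<Sum>n\<in>F. c n * sin (t n * \<xi>)"
  have "(norm (iexp (x * \<xi>) - (\<Sum>n\<in>F. of_real (c n) * iexp (t n * \<xi>))))\<^sup>2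
      = (cos (x * \<xi>) - ?C)\<^sup>2 + (sin (x * \<xi>) - ?S)\<^sup>2"
    by (simp add: cmod_power2 Re_exp Im_exp)
  also have "\<dots> = ((cos (x * \<xi>))\<^sup>2 + (sin (x * \<xi>))\<^sup>2) - 2 * (cos (x * \<xi>) * ?C + sin (x * \<xi>) * ?S) + (?C * ?C + ?S * ?S)"
    by (simp add: power2_eq_square algebra_simps)
  also have "(cos (x * \<xi>))\<^sup>2 + (sin (x * \<xi>))\<^sup>2 = 1" by simp
  also have "cos (x * \<xi>) * ?C + sin (x * \<xi>) * ?S = (\<Sum>n\<in>F. c n * cos ((x - t n) * \<xi>))"
    by (simp add: sum_distrib_left left_diff_distrib cos_diff sum.distrib[symmetric] algebra_simps)
  also have "?C * ?C + ?S * ?S = (\<Sum>n\<in>F. \<Sum>m\<in>F. c n * c m * cos ((t n - t m) * \<xi>))"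
    by (simp add: sum_product left_diff_distrib cos_diff sum.distrib[symmetric] algebra_simps)
  finally show ?thesis .
qed

text \<open>The \<open>c n\<close> are the Fourier coefficients of \<open>\<xi> \<mapsto> exp (i x \<xi>)\<close> on \<open>[-W, W]\<close>, so the
  squared distance to the partial sum is the squared norm minus the squares of the coefficients.\<close>

lemma integral_norm_sinc_expansion_squared:
  fixes F :: "int set" and x W :: real
  assumes W: "W > 0" and F: "finite F"
  defines "c \<equiv> \<lambda>n. normalized_sinc (W * x / pi - of_int n)"
  shows "(LINT \<xi>|lborel. (norm (indicator {-W..W} \<xi> *\<^sub>R
       (iexp (x * \<xi>) - (\<Sum>n\<in>F. of_real (c n) * iexp (of_int n * (pi / W) * \<xi>)))))\<^sup>2)
     = 2 * W * (1 - (\<Sum>n\<in>F. (c n)\<^sup>2))"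
    and "square_integrable (\<lambda>\<xi>. indicator {-W..W} \<xi> *\<^sub>R
       (iexp (x * \<xi>) - (\<Sum>n\<in>F. of_real (c n) * iexp (of_int n * (pi / W) * \<xi>))))"
proof -
  let ?E = "\<lambda>\<xi>. iexp (x * \<xi>) - (\<Sum>n\<in>F. of_real (c n) * iexp (of_int n * (pi / W) * \<xi>))"
  have sq: "(norm (indicator {-W..W} \<xi> *\<^sub>R ?E \<xi>))\<^sup>2 = indicator {-W..W} \<xi> *\<^sub>R (norm (?E \<xi>))\<^sup>2" for \<xi>
    by (auto simp: indicator_def)
  have setint: "set_integrable lborel {-W..W} (\<lambda>\<xi>. (norm (?E \<xi>))\<^sup>2)"
    by (intro borel_integrable_atLeastAtMost' continuous_intros)
  show "square_integrable (\<lambda>\<xi>. indicator {-W..W} \<xi> *\<^sub>R ?E \<xi>)"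
    using setint unfolding square_integrable_def sq set_integrable_def by simp
  have diag: "normalized_sinc ((of_int n * (pi / W) - of_int m * (pi / W)) * W / pi) = (if n = m then 1 else 0)" for n m
  proof -
    have "(of_int n * (pi / W) - of_int m * (pi / W)) * W / pi = of_int (n - m)"
      using W by (simp add: field_simps)
    then show ?thesis by (simp only: normalized_sinc_of_int) simp
  qed
  have cn: "normalized_sinc ((x - of_int n * (pi / W)) * W / pi) = c n" for n
  proof -
    have "(x - of_int n * (pi / W)) * W / pi = W * x / pi - of_int n" using W by (simp add: field_simps)
    then show ?thesis by (simp only: c_def)
  qed
  have "((\<lambda>\<xi>. (norm (?E \<xi>))\<^sup>2) has_integral
      (2 * W - 2 * (\<Sum>n\<in>F. c n * (2 * W * c n))
        + (\<Sum>n\<in>F. \<Sum>m\<in>F. c n * c m * (2 * W * (if n = m then 1 else 0))))) {-W..W}"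
    unfolding norm_iexp_minus_sum_squared
    using F W integral_cos_interval[OF W] has_integral_const_real[of "1::real" "-W" W]
    by (intro has_integral_add has_integral_diff has_integral_mult_right has_integral_sum)
       (auto simp flip: diag cn)
  moreover have "(\<Sum>n\<in>F. \<Sum>m\<in>F. c n * c m * (2 * W * (if n = m then 1 else 0))) = (\<Sum>n\<in>F. 2 * W * (c n)\<^sup>2)"
    using F by (intro sum.cong refl) (simp add: if_distrib power2_eq_square cong: if_cong)
  moreover have "(\<Sum>n\<in>F. c n * (2 * W * c n)) = (\<Sum>n\<in>F. 2 * W * (c n)\<^sup>2)"
    by (simp add: power2_eq_square mult_ac)
  ultimately have "integral {-W..W} (\<lambda>\<xi>. (norm (?E \<xi>))\<^sup>2) = 2 * W * (1 - (\<Sum>n\<in>F. (c n)\<^sup>2))"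
    by (simp add: integral_unique sum_distrib_left right_diff_distrib)
  then show "(LINT \<xi>|lborel. (norm (indicator {-W..W} \<xi> *\<^sub>R ?E \<xi>))\<^sup>2) = 2 * W * (1 - (\<Sum>n\<in>F. (c n)\<^sup>2))"
    unfolding sq using set_borel_integral_eq_integral(2)[OF setint] by (simp add: set_lebesgue_integral_def)
qed

lemma fourier_integral_sampling:
  fixes G :: "real \<Rightarrow> complex" and W x :: real
  assumes W: "W > 0" and G: "square_integrable G" and supp: "\<And>\<xi>. \<bar>\<xi>\<bar> > W \<Longrightarrow> G \<xi> = 0"
  shows "((\<lambda>n::int. fourier_integral G (of_int n * (pi / W)) * of_real (normalized_sinc (W * x / pi - of_int n)))
    has_sum fourier_integral G x) UNIV"
proof -
  define c where "c = (\<lambda>n::int. normalized_sinc (W * x / pi - of_int n))"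
  define K where "K = (LINT \<xi>|lborel. (norm (G \<xi>))\<^sup>2)"
  have GI: "indicator {-W..W} \<xi> *\<^sub>R G \<xi> = G \<xi>" for \<xi>
    using supp[of \<xi>] by (auto simp: indicator_def)
  have Gi: "integrable lborel G"
    using square_integrable_imp_integrable_Icc[OF G, of "-W" W] by (simp only: GI)
  have bound: "norm ((\<Sum>n\<in>F. fourier_integral G (of_int n * (pi / W)) * of_real (c n)) - fourier_integral G x)
      \<le> sqrt (K * (2 * W * (1 - (\<Sum>n\<in>F. (c n)\<^sup>2))))" if F: "finite F" for F
  proof -
    let ?E = "\<lambda>\<xi>. iexp (x * \<xi>) - (\<Sum>n\<in>F. of_real (c n) * iexp (of_int n * (pi / W) * \<xi>))"
    have "fourier_integral G x - (\<Sum>n\<in>F. fourier_integral G (of_int n * (pi / W)) * of_real (c n))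
       = (LINT \<xi>|lborel. G \<xi> * iexp (x * \<xi>)) - (\<Sum>n\<in>F. LINT \<xi>|lborel. G \<xi> * iexp (of_int n * (pi / W) * \<xi>) * of_real (c n))"
      unfolding fourier_integral_def by (simp only: integral_mult_left_zero)
    also have "\<dots> = (LINT \<xi>|lborel. G \<xi> * iexp (x * \<xi>) - (\<Sum>n\<in>F. G \<xi> * iexp (of_int n * (pi / W) * \<xi>) * of_real (c n)))"
      by (subst Bochner_Integration.integral_diff Bochner_Integration.integral_sum
            | intro integrable_mult_iexp Gi Bochner_Integration.integrable_sum integrable_mult_left refl)+
    also have "\<dots> = (LINT \<xi>|lborel. G \<xi> * (indicator {-W..W} \<xi> *\<^sub>R ?E \<xi>))"
    proof (intro Bochner_Integration.integral_cong refl)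
      fix \<xi>
      have "G \<xi> * iexp (x * \<xi>) - (\<Sum>n\<in>F. G \<xi> * iexp (of_int n * (pi / W) * \<xi>) * of_real (c n)) = G \<xi> * ?E \<xi>"
        by (simp only: right_diff_distrib sum_distrib_left mult.assoc mult.commute[of "of_real (c _)"])
      also have "\<dots> = G \<xi> * (indicator {-W..W} \<xi> *\<^sub>R ?E \<xi>)"
        using supp[of \<xi>] by (auto simp: indicator_def)
      finally show "G \<xi> * iexp (x * \<xi>) - (\<Sum>n\<in>F. G \<xi> * iexp (of_int n * (pi / W) * \<xi>) * of_real (c n)) 
        = G \<xi> * (indicator {-W..W} \<xi> *\<^sub>R ?E \<xi>)" .
    qed
    finally have eq: "fourier_integral G x - (\<Sum>n\<in>F. fourier_integral G (of_int n * (pi / W)) * of_real (c n))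
      = (LINT \<xi>|lborel. G \<xi> * (indicator {-W..W} \<xi> *\<^sub>R ?E \<xi>))" .
    have "(norm (LINT \<xi>|lborel. G \<xi> * (indicator {-W..W} \<xi> *\<^sub>R ?E \<xi>)))\<^sup>2 \<le> K * (2 * W * (1 - (\<Sum>n\<in>F. (c n)\<^sup>2)))"
      using cauchy_schwarz_integral[OF G integral_norm_sinc_expansion_squared(2)[OF W F, of x]]
      unfolding integral_norm_sinc_expansion_squared(1)[OF W F] K_def c_def .
    then show ?thesis
      unfolding eq[symmetric] by (subst norm_minus_commute) (rule real_le_rsqrt)
  qed
  have "((\<lambda>F. \<Sum>n\<in>F. (c n)\<^sup>2) \<longlongrightarrow> 1) (finite_subsets_at_top UNIV)"
    using has_sum_normalized_sinc_squared[of "W * x / pi"] by (simp add: has_sum_def c_def)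
  then have "((\<lambda>F. sqrt (K * (2 * W * (1 - (\<Sum>n\<in>F. (c n)\<^sup>2))))) \<longlongrightarrow> sqrt (K * (2 * W * (1 - 1)))) (finite_subsets_at_top UNIV)"
    by (intro tendsto_intros)
  then have lim: "((\<lambda>F. sqrt (K * (2 * W * (1 - (\<Sum>n\<in>F. (c n)\<^sup>2))))) \<longlongrightarrow> 0) (finite_subsets_at_top UNIV)"
    by simp
  have "((\<lambda>F. (\<Sum>n\<in>F. fourier_integral G (of_int n * (pi / W)) * of_real (c n)) - fourier_integral G x) \<longlongrightarrow> 0) (finite_subsets_at_top UNIV)"
    by (rule Lim_null_comparison[OF _ lim]) (rule eventually_finite_subsets_at_top_weakI, rule bound)
  then show ?thesis
    unfolding has_sum_def c_def by (rule LIM_zero_cancel)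
qed

section \<open>The special affine Fourier transform\<close>

lemma norm_exp_i_real:
  "norm (exp (\<i> / (2 * of_real b) * of_real r)) = 1" "norm (exp (- (\<i> / (2 * of_real b)) * of_real r)) = 1"
proof -
  have "\<i> / (2 * of_real b) * of_real r = \<i> * of_real (r / (2 * b))"
    "- (\<i> / (2 * of_real b)) * of_real r = \<i> * of_real (- r / (2 * b))" by simp_all
  then show "norm (exp (\<i> / (2 * of_real b) * of_real r)) = 1" "norm (exp (- (\<i> / (2 * of_real b)) * of_real r)) = 1"
    by (simp_all only: norm_exp_i_times)
qed

theorem theorem2p5:
  fixes A B C D p q \<Omega> T :: real and M :: "real^2^2" and L :: "real^2"
    and f :: "real \<Rightarrow> complex"
  assumes "M = vector [vector [A, B], vector [C, D]]"
    and "L = vector [p, q]"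
    and "det M = 1"
    and "B > 0"
    and "\<Omega> > 0"
    and "square_integrable f"
    and "saft_band_limited M L \<Omega> f"
    and "T = B * pi / \<Omega>"
  shows "\<exists>f0. continuous_representative f f0 \<and>
    (\<forall>x::real.
      (\<lambda>n::int. f0 (of_int n * T) *
          exp (\<i> / (2 * of_real B) * of_real (A * (of_int n * T)\<^sup>2 + 2 * p * (of_int n * T))) *
          of_real (normalized_sinc (\<Omega> * (x - of_int n * T) / (B * pi)))) summable_on UNIV \<and>
      f0 x = exp (- (\<i> / (2 * of_real B)) * of_real (A * x\<^sup>2 + 2 * x * p)) *
        (\<Sum>\<^sub>\<infinity>n::int. f0 (of_int n * T) *
          exp (\<i> / (2 * of_real B) * of_real (A * (of_int n * T)\<^sup>2 + 2 * p * (of_int n * T))) *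
          of_real (normalized_sinc (\<Omega> * (x - of_int n * T) / (B * pi)))))"
proof -
  have B: "B > 0" and f: "square_integrable f" using assms by auto
  have entries: "M $ 1 $ 1 = A" "M $ 1 $ 2 = B" "M $ 2 $ 2 = D" "L $ 1 = p" "L $ 2 = q"
    unfolding assms(1,2) by simp_all
  obtain g where g: "square_integrable g"
    and lim: "((\<lambda>R. \<integral>\<^sup>+ \<zeta>. ennreal ((norm (saft_truncated M L f R \<zeta> - g \<zeta>))\<^sup>2) \<partial>lborel) \<longlongrightarrow> 0) at_top"
    and g0: "AE \<zeta> in lborel. \<bar>\<zeta>\<bar> \<ge> \<Omega> \<longrightarrow> g \<zeta> = 0"
    using assms(7) by (auto simp: saft_band_limited_def has_saft_def)
  have [measurable]: "f \<in> borel_measurable borel" "g \<in> borel_measurable borel"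
    using f g by (auto simp: square_integrable_def)
  define e where "e = (\<lambda>x. exp (\<i> / (2 * of_real B) * of_real (A * x\<^sup>2 + 2 * p * x)))"
  define e' where "e' = (\<lambda>x. exp (- (\<i> / (2 * of_real B)) * of_real (A * x\<^sup>2 + 2 * x * p)))"
  have e_fold: "exp (\<i> / (2 * of_real B) * of_real (A * x\<^sup>2 + 2 * p * x)) = e x"
    "exp (- (\<i> / (2 * of_real B)) * of_real (A * x\<^sup>2 + 2 * x * p)) = e' x" for x
    by (simp_all only: e_def e'_def)
  define h where "h = (\<lambda>x. f x * e x)"
  \<comment> \<open>The part of the kernel that depends on \<open>\<zeta>\<close> alone; its modulus is the constant \<open>k\<close>.\<close>
  define \<gamma> where "\<gamma> = (\<lambda>\<zeta>. 1 / csqrt (2 * of_real pi * \<i> * of_real B) *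
    exp (\<i> / (2 * of_real B) * of_real (- 2 * \<zeta> * (D * p - B * q) + D * (\<zeta>\<^sup>2 + p\<^sup>2))))"
  define k where "k = norm (1 / csqrt (2 * of_real pi * \<i> * of_real B))"
  define W where "W = \<Omega> / B"
  have W: "W > 0" and TW: "T = pi / W" using assms by (auto simp: W_def)
  have k: "k > 0" using B by (simp add: k_def)
  have norm_\<gamma>: "norm (\<gamma> \<zeta>) = k" for \<zeta> by (simp only: \<gamma>_def k_def norm_mult norm_exp_i_real)
  have \<gamma>0: "\<gamma> \<zeta> \<noteq> 0" for \<zeta> using norm_\<gamma>[of \<zeta>] k by auto
  have e'e: "e' x * e x = 1" for x by (simp add: e'_def e_def exp_add[symmetric] mult_ac)
  have cont_e: "continuous_on UNIV e" "continuous_on UNIV e'" "continuous_on UNIV \<gamma>"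
    unfolding e_def e'_def \<gamma>_def by (intro continuous_intros; simp)+
  then have [measurable]: "e \<in> borel_measurable borel" "\<gamma> \<in> borel_measurable borel"
    by (auto intro: borel_measurable_continuous_onI)
  have norm_e: "norm (e x) = 1" for x by (simp only: e_def norm_exp_i_real)
  have h: "square_integrable h"
    using f by (auto simp: square_integrable_def h_def norm_mult norm_e)
  have kernel: "saft_kernel M L x \<zeta> = \<gamma> \<zeta> * (e x * iexp (- (\<zeta> / B) * x))" for x \<zeta>
  proof -
    have "\<i> / (2 * of_real B) * of_real (A * x\<^sup>2 + 2 * x * (p - \<zeta>) - 2 * \<zeta> * (D * p - B * q) + D * (\<zeta>\<^sup>2 + p\<^sup>2))
      = \<i> / (2 * of_real B) * of_real (- 2 * \<zeta> * (D * p - B * q) + D * (\<zeta>\<^sup>2 + p\<^sup>2))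
        + (\<i> / (2 * of_real B) * of_real (A * x\<^sup>2 + 2 * p * x) + \<i> * of_real (- (\<zeta> / B) * x))"
      using B by (simp add: field_simps)
    then show ?thesis
      unfolding saft_kernel_def Let_def entries \<gamma>_def e_def by (simp only: exp_add mult.assoc)
  qed
  have trunc: "saft_truncated M L f R \<zeta> = \<gamma> \<zeta> * fourier_integral (\<lambda>x. indicator {-R..R} x *\<^sub>R h x) (- (\<zeta> / B))" for R \<zeta>
    unfolding saft_truncated_def fourier_integral_def set_lebesgue_integral_def kernel integral_mult_right_zero[symmetric]
    by (intro Bochner_Integration.integral_cong) (simp_all add: h_def indicator_def)
  \<comment> \<open>The Fourier transform of \<open>h\<close>, made to vanish everywhere outside \<open>[-W, W]\<close>, where \<open>g\<close> vanishes
    only almost everywhere.\<close>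
  define G where "G = (\<lambda>\<xi>. if \<bar>\<xi>\<bar> \<le> W then g (B * \<xi>) / \<gamma> (B * \<xi>) else 0)"
  have [measurable]: "G \<in> borel_measurable borel" unfolding G_def by measurable
  have "AE \<xi> in lborel. \<bar>0 + B * \<xi>\<bar> \<ge> \<Omega> \<longrightarrow> g (0 + B * \<xi>) = 0"
    using B g0 by (intro AE_borel_affine) auto
  then have GAE: "AE \<xi> in lborel. G \<xi> = g (B * \<xi>) / \<gamma> (B * \<xi>)"
  proof eventually_elim
    case (elim \<xi>)
    then show ?case using B by (auto simp: G_def W_def abs_mult field_simps)
  qed
  have G2: "square_integrable G"
  proof -
    have "integrable lborel (\<lambda>\<xi>. (norm (g (0 + B * \<xi>)))\<^sup>2 / k\<^sup>2)"
      using g B by (intro integrable_divide lborel_integrable_real_affine) (auto simp: square_integrable_def)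
    then have "integrable lborel (\<lambda>\<xi>. (norm (G \<xi>))\<^sup>2)"
      by (rule Bochner_Integration.integrable_bound) (auto simp: G_def norm_divide norm_\<gamma> power_divide)
    then show ?thesis by (simp add: square_integrable_def)
  qed
  have GI: "indicator {-W..W} \<xi> *\<^sub>R G \<xi> = G \<xi>" for \<xi>
    by (auto simp: indicator_def G_def)
  have Gi: "integrable lborel G"
    using square_integrable_imp_integrable_Icc[OF G2, of "-W" W] by (simp only: GI)
  have dist_eq: "(\<integral>\<^sup>+\<xi>. ennreal ((norm (fourier_integral (\<lambda>x. indicator {-R..R} x *\<^sub>R h x) (-\<xi>) - G \<xi>))\<^sup>2) \<partial>lborel)
     = ennreal (1 / (k\<^sup>2 * B)) * (\<integral>\<^sup>+ \<zeta>. ennreal ((norm (saft_truncated M L f R \<zeta> - g \<zeta>))\<^sup>2) \<partial>lborel)" for R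
  proof -
    let ?F = "fourier_integral (\<lambda>x. indicator {-R..R} x *\<^sub>R h x)"
    have "continuous_on UNIV ?F"
      by (intro continuous_fourier_integral square_integrable_imp_integrable_Icc h)
    then have [measurable]: "?F \<in> borel_measurable borel" by (rule borel_measurable_continuous_onI)
    have [measurable]: "saft_truncated M L f R \<in> borel_measurable borel"
      unfolding trunc[abs_def] by measurable
    have "(\<integral>\<^sup>+\<xi>. ennreal ((norm (?F (-\<xi>) - G \<xi>))\<^sup>2) \<partial>lborel)
      = (\<integral>\<^sup>+\<xi>. ennreal (1 / k\<^sup>2) * ennreal ((norm (saft_truncated M L f R (0 + B * \<xi>) - g (0 + B * \<xi>)))\<^sup>2) \<partial>lborel)"
    proof (rule nn_integral_cong_AE)
      show "AE \<xi> in lborel. ennreal ((norm (?F (-\<xi>) - G \<xi>))\<^sup>2)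
        = ennreal (1 / k\<^sup>2) * ennreal ((norm (saft_truncated M L f R (0 + B * \<xi>) - g (0 + B * \<xi>)))\<^sup>2)"
        using GAE
      proof eventually_elim
        case (elim \<xi>)
        have "saft_truncated M L f R (0 + B * \<xi>) - g (0 + B * \<xi>) = \<gamma> (B * \<xi>) * (?F (-\<xi>) - G \<xi>)"
          using B \<gamma>0[of "B * \<xi>"] by (simp add: trunc elim field_simps)
        then have "(norm (saft_truncated M L f R (0 + B * \<xi>) - g (0 + B * \<xi>)))\<^sup>2 = k\<^sup>2 * (norm (?F (-\<xi>) - G \<xi>))\<^sup>2"
          by (simp add: norm_mult norm_\<gamma> power_mult_distrib)
        then show ?case using k by (simp add: ennreal_mult[symmetric])
      qed
    qed
    also have "\<dots> = ennreal (1 / k\<^sup>2) * (\<integral>\<^sup>+\<xi>. ennreal ((norm (saft_truncated M L f R (0 + B * \<xi>) - g (0 + B * \<xi>)))\<^sup>2) \<partial>lborel)"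
      by (rule nn_integral_cmult) measurable
    also have "(\<integral>\<^sup>+\<xi>. ennreal ((norm (saft_truncated M L f R (0 + B * \<xi>) - g (0 + B * \<xi>)))\<^sup>2) \<partial>lborel)
      = ennreal (1 / B) * (\<integral>\<^sup>+ \<zeta>. ennreal ((norm (saft_truncated M L f R \<zeta> - g \<zeta>))\<^sup>2) \<partial>lborel)"
      using B by (subst nn_integral_real_affine[of "\<lambda>\<zeta>. ennreal ((norm (saft_truncated M L f R \<zeta> - g \<zeta>))\<^sup>2)" B 0])
         (auto simp: mult.assoc[symmetric] ennreal_mult[symmetric])
    also have "ennreal (1 / k\<^sup>2) * (ennreal (1 / B) * (\<integral>\<^sup>+ \<zeta>. ennreal ((norm (saft_truncated M L f R \<zeta> - g \<zeta>))\<^sup>2) \<partial>lborel))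
      = ennreal (1 / (k\<^sup>2 * B)) * (\<integral>\<^sup>+ \<zeta>. ennreal ((norm (saft_truncated M L f R \<zeta> - g \<zeta>))\<^sup>2) \<partial>lborel)"
      using B k by (simp add: mult.assoc[symmetric] ennreal_mult[symmetric])
    finally show ?thesis .
  qed
  have "((\<lambda>R. \<integral>\<^sup>+\<xi>. ennreal ((norm (fourier_integral (\<lambda>x. indicator {-R..R} x *\<^sub>R h x) (-\<xi>) - G \<xi>))\<^sup>2) \<partial>lborel)
      \<longlongrightarrow> ennreal (1 / (k\<^sup>2 * B)) * 0) at_top"
    unfolding dist_eq by (intro ennreal_tendsto_cmult lim) simp
  then have hG: "AE x in lborel. h x = fourier_integral G x / (2 * pi)"
    by (intro fourier_inversion_L2[OF h G2 Gi]) simp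
  define f0 where "f0 = (\<lambda>x. e' x * (fourier_integral G x / (2 * pi)))"
  have rep: "continuous_representative f f0"
    unfolding continuous_representative_def
  proof
    show "continuous_on UNIV f0"
      unfolding f0_def by (intro continuous_intros cont_e continuous_fourier_integral Gi) simp
    show "AE x in lborel. f0 x = f x"
      using hG
    proof eventually_elim
      case (elim x)
      then have "f0 x = e' x * h x" by (simp add: f0_def)
      then have "f0 x = (e' x * e x) * f x" by (simp add: h_def)
      then show ?case by (simp add: e'e)
    qed
  qed
  have samples: "((\<lambda>n::int. f0 (of_int n * T) * e (of_int n * T) *
      of_real (normalized_sinc (\<Omega> * (x - of_int n * T) / (B * pi)))) has_sum fourier_integral G x / (2 * pi)) UNIV" for x
  proof -
    have summand: "f0 (of_int n * T) * e (of_int n * T) * of_real (normalized_sinc (\<Omega> * (x - of_int n * T) / (B * pi)))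
      = fourier_integral G (of_int n * (pi / W)) * of_real (normalized_sinc (W * x / pi - of_int n)) * (1 / (2 * pi))" for n :: int
    proof -
      have "f0 (of_int n * T) * e (of_int n * T) = (e' (of_int n * T) * e (of_int n * T)) * (fourier_integral G (of_int n * T) / (2 * pi))"
        by (simp add: f0_def)
      moreover have "\<Omega> * (x - of_int n * T) / (B * pi) = W * x / pi - of_int n"
        using B assms(5) by (simp add: assms(8) W_def field_simps)
      ultimately show ?thesis by (simp add: e'e TW)
    qed
    have "((\<lambda>n::int. fourier_integral G (of_int n * (pi / W)) * of_real (normalized_sinc (W * x / pi - of_int n)) * (1 / (2 * pi)))
        has_sum (fourier_integral G x * (1 / (2 * pi)))) UNIV"
      by (intro has_sum_cmult_left fourier_integral_sampling W G2) (simp add: G_def)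
    then show ?thesis unfolding summand by simp
  qed
  show ?thesis
    unfolding e_fold
  proof (intro exI[of _ f0] conjI allI rep)
    fix x
    show "(\<lambda>n::int. f0 (of_int n * T) * e (of_int n * T) *
      of_real (normalized_sinc (\<Omega> * (x - of_int n * T) / (B * pi)))) summable_on UNIV"
      using samples[of x] by (rule has_sum_imp_summable)
    show "f0 x = e' x * (\<Sum>\<^sub>\<infinity>n::int. f0 (of_int n * T) * e (of_int n * T) *
      of_real (normalized_sinc (\<Omega> * (x - of_int n * T) / (B * pi))))"
      unfolding infsumI[OF samples] by (simp add: f0_def)
  qed
qed

end
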